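(* Let $\pi(n)=\sum_{p\le n}1$ be the prime-counting function. The truncation trajectory $\tau_\pi(n)$, i.e. the real parameter satisfying $$\operatorname{li}(n;\tau_\pi(n))=\pi(n)\qquad(n\ge 2\text{ real}),$$ exists uniquely, and $n\mapsto\tau_\pi(n)$ is continuous on every open interval $(p_m,p_{m+1})$ between consecutive primes. At any point $n$ of such an interval where $\tau_\pi(n)=k\in\mathbb{N}$ is an integer, $\tau_\pi$ is continuous but is not differentiable, having a vertical tangent line there.
   Context: Septic parametric logarithmic operator: for real $n>1$ and a real truncation parameter $\tau\in\mathbb{R}^+$, put $k=\lfloor\tau\rfloor\in\mathbb{N}_0$ and define $$\operatorname{li}(n;\tau)=\frac{n}{\ln n}\left(\sum_{j=0}^{k-1}\frac{j!}{\ln^j n}+\phi(\tau-\lfloor\tau\rfloor)\frac{k!}{\ln^k n}\right),\qquad \phi(x)=35x^4-84x^5+70x^6-20x^7 .$$ The empty sum is $0$, so $\operatorname{li}(n;\tau)=\frac{n}{\ln n}\phi(\tau)$ for $\tau\in[0,1]$. Here $\ln^j n=(\ln n)^j$, $n$ is a real variable, and $p_m$ is the $m$-th prime. *)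

theory Defs
  imports Complex_Main "HOL-Computational_Algebra.Primes" "HOL-Library.Infinite_Set"
begin

definition phi :: "real \<Rightarrow> real" where
  "phi x = 35 * x ^ 4 - 84 * x ^ 5 + 70 * x ^ 6 - 20 * x ^ 7"

text \<open>Meant for \<open>n > 1\<close> and \<open>\<tau> \<ge> 0\<close>, where \<open>nat \<lfloor>\<tau>\<rfloor>\<close> is the floor of \<open>\<tau>\<close>.\<close>

definition li :: "real \<Rightarrow> real \<Rightarrow> real" where
  "li n \<tau> = (let k = nat \<lfloor>\<tau>\<rfloor> in
     n / ln n * ((\<Sum>j<k. fact j / ln n ^ j) + phi (frac \<tau>) * (fact k / ln n ^ k)))"

definition prime_pi :: "real \<Rightarrow> nat" where
  "prime_pi x = card {p::nat. prime p \<and> real p \<le> x}"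

text \<open>Primes are numbered from \<open>1\<close>, so \<open>nth_prime 1 = 2\<close>, whereas \<open>enumerate\<close> counts from \<open>0\<close>;
  the index \<open>0\<close> is not used.\<close>

definition nth_prime :: "nat \<Rightarrow> nat" where
  "nth_prime m = enumerate {p. prime p} (m - 1)"

definition tau_pi :: "real \<Rightarrow> real" where
  "tau_pi n = (THE \<tau>. 0 < \<tau> \<and> li n \<tau> = real (prime_pi n))"

text \<open>The two-sided limit of the difference quotient is \<open>+\<infinity>\<close> or \<open>-\<infinity>\<close>; cusps, where the two
  one-sided limits are infinite of opposite sign, do not count.\<close>

definition has_vertical_tangent :: "(real \<Rightarrow> real) \<Rightarrow> real \<Rightarrow> bool" where
  "has_vertical_tangent f a \<longleftrightarrow> isCont f a \<and>
     (filterlim (\<lambda>x. (f x - f a) / (x - a)) at_top (at a) \<or>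
      filterlim (\<lambda>x. (f x - f a) / (x - a)) at_bot (at a))"

end

theory Submission
  imports Defs "HOL-Analysis.Analysis" "HOL-Number_Theory.Eratosthenes"
begin

text \<open>
  For fixed \<open>n > 1\<close> the map \<open>\<tau> \<mapsto> li n \<tau>\<close> increases continuously from \<open>0\<close> to \<open>\<infinity>\<close>, which gives
  existence, uniqueness and (as \<open>prime_pi\<close> is constant between primes) continuity of \<open>tau_pi\<close>.
  Near an integer value \<open>k\<close> of \<open>\<tau>\<close> the function \<open>phi\<close> is flat to fourth order, so
  \<open>li n \<tau> - li n k = O(\<bar>\<tau> - k\<bar> ^ 4)\<close>. Hence the tangent is vertical as soon as the derivative
  \<open>1 / ln n - fact k / ln n ^ (k + 1)\<close> of \<open>n \<mapsto> li n k\<close> does not vanish.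
  If it did vanish, that is if \<open>ln n ^ k = fact k\<close>, there would be a cusp instead. This is excluded
  because for such \<open>n\<close> and large \<open>k\<close> the value \<open>li n k\<close> is at least about
  \<open>e / (e - 1) * n / ln n\<close>, which exceeds \<open>prime_pi n\<close> by a Chebyshev bound with a constant close
  to \<open>3 / 2\<close>; the small \<open>k\<close> are treated numerically.
\<close>

subsection \<open>Bounds for the prime-counting function\<close>

lemma finite_primes_le: "finite {p::nat. prime p \<and> p \<le> n}"
  by (rule finite_subset[of _ "{..n}"]) auto

lemma prime_pi_of_nat: "prime_pi (real n) = card {p::nat. prime p \<and> p \<le> n}"
  by (simp add: prime_pi_def)

lemma prime_pi_eq_floor:
  assumes "x \<ge> 0"
  shows "prime_pi x = prime_pi (real (nat \<lfloor>x\<rfloor>))"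
proof -
  have "real p \<le> x \<longleftrightarrow> p \<le> nat \<lfloor>x\<rfloor>" for p
    using assms by (simp add: le_nat_iff le_floor_iff)
  then show ?thesis
    by (simp add: prime_pi_def)
qed

lemma primes_le_Suc:
  "{p::nat. prime p \<and> p \<le> Suc n} =
     (if prime (Suc n) then insert (Suc n) {p. prime p \<and> p \<le> n} else {p. prime p \<and> p \<le> n})"
  by (auto simp: le_Suc_eq)

lemma prime_pi_Suc:
  "prime_pi (real (Suc n)) = prime_pi (real n) + (if prime (Suc n) then 1 else 0)"
  unfolding prime_pi_of_nat primes_le_Suc by (simp add: finite_primes_le)

text \<open>A prime above 3 is odd and not a multiple of 3. Of \<open>3 * a + 1\<close> and
  \<open>3 * a + 2\<close> only one is odd, so \<open>p div 3\<close> determines \<open>p\<close>.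
  The primes 2 and 3 are counted separately.\<close>

lemma prime_pi_le_third:
  assumes "x \<ge> 1"
  shows "real (prime_pi x) \<le> (x + 5) / 3"
proof -
  define N where "N = nat \<lfloor>x\<rfloor>"
  have N: "N \<ge> 1" "real N \<le> x"
    using assms unfolding N_def by (auto simp: le_nat_iff le_floor_iff)
  let ?P = "{p::nat. prime p \<and> 3 < p \<and> p \<le> N}"
  have res: "odd p \<and> (p = 3 * (p div 3) + 1 \<or> p = 3 * (p div 3) + 2)" if "p \<in> ?P" for p
  proof -
    from that have p: "prime p" "p > 3" by auto
    have "odd p" "\<not> 3 dvd p"
      using p primes_dvd_imp_eq[of 2 p] primes_dvd_imp_eq[of 3 p] by auto
    moreover from this(2) have "p mod 3 = 1 \<or> p mod 3 = 2"
      by (simp add: dvd_eq_mod_eq_0) linarith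
    ultimately show ?thesis
      using mult_div_mod_eq[of 3 p] by metis
  qed
  have inj: "inj_on (\<lambda>p. p div 3) ?P"
  proof (rule inj_onI)
    fix p q assume pq: "p \<in> ?P" "q \<in> ?P" "p div 3 = q div 3"
    obtain a where a: "a = p div 3" "a = q div 3" using pq(3) by simp
    have "odd p" "odd q" "p = 3 * a + 1 \<or> p = 3 * a + 2" "q = 3 * a + 1 \<or> q = 3 * a + 2"
      using res[OF pq(1)] res[OF pq(2)] a by auto
    then show "p = q" by (elim disjE) auto
  qed
  have "(\<lambda>p. p div 3) ` ?P \<subseteq> {1..(N - 1) div 3}"
  proof
    fix y assume "y \<in> (\<lambda>p. p div 3) ` ?P"
    then obtain p where p: "p \<in> ?P" "y = p div 3" by auto
    then have "3 < p" "p \<le> N" by auto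
    moreover have "p = 3 * y + 1 \<or> p = 3 * y + 2" using res[OF p(1)] p(2) by auto
    ultimately show "y \<in> {1..(N - 1) div 3}"
      unfolding atLeastAtMost_iff by linarith
  qed
  then have "card ?P \<le> card {1..(N - 1) div 3}"
    using inj by (metis card_image card_mono finite_atLeastAtMost)
  then have cP: "card ?P \<le> (N - 1) div 3" by simp
  have "{p. prime p \<and> p \<le> N} \<subseteq> {2, 3} \<union> ?P"
  proof
    fix p assume p: "p \<in> {p. prime p \<and> p \<le> N}"
    then have "p \<ge> 2" using prime_ge_2_nat by auto
    with p show "p \<in> {2, 3} \<union> ?P" by auto
  qed
  moreover have "finite ?P" by simp
  ultimately have "card {p. prime p \<and> p \<le> N} \<le> card ({2, 3} \<union> ?P)"
    by (intro card_mono) auto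
  also have "\<dots> \<le> card {2, 3::nat} + card ?P" by (rule card_Un_le)
  finally have "3 * card {p. prime p \<and> p \<le> N} \<le> N + 5"
    using cP N(1) by simp
  then have "3 * real (prime_pi (real N)) \<le> real N + 5"
    unfolding prime_pi_of_nat by linarith
  moreover have "prime_pi x = prime_pi (real N)"
    unfolding N_def using assms by (intro prime_pi_eq_floor) simp
  ultimately show ?thesis
    using N(2) by simp
qed

section \<open>Chebyshev's upper bound for the primorial\<close>

lemma prod_primes_dvd:
  fixes n :: nat
  assumes "finite A" "\<And>p. p \<in> A \<Longrightarrow> prime p" "\<And>p. p \<in> A \<Longrightarrow> p dvd n"
  shows "\<Prod>A dvd n"
  using assms
proof (induction A)
  case (insert p A)
  have "coprime p (\<Prod>A)"
  proof (rule prod_coprime_right)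
    fix q assume "q \<in> A"
    then show "coprime p q"
      using insert by (metis insertCI primes_coprime)
  qed
  then show ?case
    using insert by (simp add: divides_mult)
qed simp

text \<open>Its logarithm is Chebyshev's function \<theta>; the integer form allows divisibility
  arguments.\<close>

definition primorial :: "nat \<Rightarrow> nat" where
  "primorial n = \<Prod>{p. prime p \<and> p \<le> n}"

lemma primorial_0 [simp]: "primorial 0 = 1"
proof -
  have "{p::nat. prime p \<and> p \<le> 0} = {}" by (auto dest: prime_gt_0_nat)
  then show ?thesis by (simp only: primorial_def prod.empty)
qed

lemma primorial_Suc:
  "primorial (Suc n) = (if prime (Suc n) then Suc n * primorial n else primorial n)"
  unfolding primorial_def primes_le_Suc by (simp add: finite_primes_le)

lemma primorial_pos: "primorial n > 0"
  unfolding primorial_def by (rule prod_pos) (auto simp: prime_gt_0_nat)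

text \<open>The coefficient occurs twice, by symmetry, in a row with sum
  \<open>2 * 4 ^ m\<close>.\<close>

lemma binomial_odd_le: "(2 * m + 1) choose m \<le> 4 ^ m"
proof -
  have "(2 * m + 1) choose m = (2 * m + 1) choose (m + 1)"
    by (subst binomial_symmetric) auto
  moreover have "(\<Sum>k\<in>{m, m + 1}. (2 * m + 1) choose k) \<le> (\<Sum>k\<le>2 * m + 1. (2 * m + 1) choose k)"
    by (intro sum_mono2) auto
  moreover have "(\<Sum>k\<le>2 * m + 1. (2 * m + 1) choose k) = 2 * 4 ^ m"
    by (simp only: choose_row_sum) (simp add: power_mult)
  ultimately show ?thesis by simp
qed

text \<open>Every prime between \<open>m + 2\<close> and \<open>2 m + 1\<close> divides the binomial coefficient of
  \<open>2 m + 1\<close> over \<open>m\<close>.\<close>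

lemma primorial_odd: "primorial (2 * m + 1) \<le> primorial (m + 1) * 4 ^ m"
proof -
  let ?Q = "{p. prime p \<and> m + 1 < p \<and> p \<le> 2 * m + 1}"
  have "{p. prime p \<and> p \<le> 2 * m + 1} = {p. prime p \<and> p \<le> m + 1} \<union> ?Q"
    by auto
  moreover have "finite ?Q" by simp
  ultimately have eq: "primorial (2 * m + 1) = primorial (m + 1) * \<Prod>?Q"
    unfolding primorial_def by (subst prod.union_disjoint[symmetric]) (auto simp: finite_primes_le)
  have "\<Prod>?Q dvd (2 * m + 1) choose m"
  proof (rule prod_primes_dvd)
    fix p assume "p \<in> ?Q"
    then have p: "prime p" "m + 1 < p" "p \<le> 2 * m + 1" by auto
    have "fact m * fact (m + 1) * ((2 * m + 1) choose m) = fact (2 * m + 1)"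
      using binomial_fact_lemma[of m "2 * m + 1"] by (simp add: mult_2)
    moreover have "p dvd fact (2 * m + 1)"
      using p by (simp add: prime_dvd_fact_iff del: fact_Suc)
    ultimately have "p dvd fact m * fact (m + 1) * ((2 * m + 1) choose m)" by simp
    moreover have "\<not> p dvd fact m" "\<not> p dvd fact (m + 1)"
      using p by (simp_all add: prime_dvd_fact_iff del: fact_Suc)
    ultimately show "p dvd (2 * m + 1) choose m"
      using p(1) by (simp add: prime_dvd_mult_iff del: fact_Suc)
  qed auto
  then have "\<Prod>?Q \<le> (2 * m + 1) choose m"
    by (rule dvd_imp_le) simp
  also note binomial_odd_le
  finally show ?thesis unfolding eq by simp
qed

text \<open>Strong induction: an odd \<open>n = 2 * m + 1\<close> reduces to \<open>m + 1\<close>,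
  the exponents adding up to \<open>(m + 1) + m = n\<close>; an even \<open>n > 2\<close> is not
  prime and reduces to \<open>n - 1\<close>.\<close>

lemma primorial_le: "primorial n \<le> 4 ^ n"
proof (induction n rule: less_induct)
  case (less n)
  consider "n \<le> 2" | "n > 2" "odd n" | "n > 2" "even n" by linarith
  then show ?case
  proof cases
    case 1
    then consider "n = 0" | "n = 1" | "n = 2" by linarith
    then show ?thesis
      by cases (simp_all add: primorial_Suc numeral_2_eq_2)
  next
    case 2
    then obtain m where m: "n = 2 * m + 1" by (elim oddE)
    have "primorial n \<le> primorial (m + 1) * 4 ^ m" using m primorial_odd by simp
    also have "\<dots> \<le> 4 ^ (m + 1) * 4 ^ m" using less.IH[of "m + 1"] 2 m by simp
    also have "\<dots> = 4 ^ n" using m by (simp add: mult_2 flip: power_add)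
    finally show ?thesis .
  next
    case 3
    have "\<not> prime n"
      using 3 primes_dvd_imp_eq[of 2 n] by auto
    then have "primorial n = primorial (n - 1)" using 3 primorial_Suc[of "n - 1"] by simp
    also have "\<dots> \<le> 4 ^ (n - 1)" using less.IH 3 by simp
    also have "\<dots> \<le> 4 ^ n" by (intro power_increasing) auto
    finally show ?thesis .
  qed
qed

text \<open>Input for the base case of the induction behind \<open>prime_pi_le\<close>. The start
  128 is a power of 2, so that its logarithm is a multiple of \<open>ln 2\<close>.\<close>

lemma primes_le_128:
  "{p::nat. prime p \<and> p \<le> 128} =
     {2,3,5,7,11,13,17,19,23,29,31,37,41,43,47,53,59,61,67,71,73,79,83,89,97,101,103,107,109,113,127}"
proof -
  have "primes_upto 128 =
    [2,3,5,7,11,13,17,19,23,29,31,37,41,43,47,53,59,61,67,71,73,79,83,89,97,101,103,107,109,113,127]"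
    by code_simp
  moreover have "{p::nat. prime p \<and> p \<le> 128} = set (primes_upto 128)"
    unfolding set_primes_upto by (rule Collect_cong) (rule conj_commute)
  ultimately show ?thesis by (simp only: list.set)
qed

lemma prime_pi_128: "prime_pi 128 = 31"
proof -
  have "prime_pi (real 128) = 31"
    unfolding prime_pi_of_nat primes_le_128 by simp
  then show ?thesis by simp
qed

lemma primorial_128: "primorial 128 \<ge> 2 ^ 160"
  unfolding primorial_def primes_le_128 by simp

section \<open>From the primorial to the number of primes\<close>

lemma prime_pi_majorant_deriv:
  assumes "t > exp 1"
  shows "((\<lambda>t. 3 / 2 * t / (ln t - 1)) has_real_derivative
            3 / 2 * (ln t - 2) / (ln t - 1)\<^sup>2) (at t)"
proof -
  have "t > 0" using assms by (meson exp_gt_zero less_trans)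
  moreover have "ln t > 1" using assms \<open>t > 0\<close> by (metis ln_exp ln_less_cancel_iff exp_gt_zero)
  moreover have "((\<lambda>t. 3 / 2 * t) has_real_derivative 3 / 2) (at t)"
    by (auto intro!: derivative_eq_intros)
  moreover have "((\<lambda>t. ln t - 1) has_real_derivative 1 / t) (at t)"
    using \<open>t > 0\<close> by (auto intro!: derivative_eq_intros)
  ultimately have "((\<lambda>t. 3 / 2 * t / (ln t - 1)) has_real_derivative
      (3 / 2 * (ln t - 1) - 3 / 2 * t * (1 / t)) / ((ln t - 1) * (ln t - 1))) (at t)"
    by (intro DERIV_divide) auto
  also have "3 / 2 * (ln t - 1) - 3 / 2 * t * (1 / t) = 3 / 2 * (ln t - 2)"
    using \<open>t > 0\<close> by (simp add: field_simps)
  finally show ?thesis by (simp only: power2_eq_square)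
qed

lemma ln_128: "ln (128::real) = 7 * ln 2"
  using ln_realpow[of 2 7] by simp

text \<open>The close inequality \<open>exp 9 < 2 ^ 13\<close> gives
  \<open>ln 2 \<ge> 9 / 13\<close>.\<close>

lemma ln_128_ge: "ln (128::real) \<ge> 63 / 13"
proof -
  have "exp (9::real) = exp 1 ^ 9" by (simp flip: exp_of_nat_mult)
  also have "\<dots> \<le> (272 / 100) ^ 9" using e_less_272 by (intro power_mono) auto
  also have "\<dots> \<le> 2 ^ 13" by (simp add: power_divide)
  finally have "ln (exp 9) \<le> ln (2 ^ 13 :: real)" by (subst ln_le_cancel_iff) auto
  then show ?thesis by (simp add: ln_128 ln_realpow del: power_numeral)
qed

text \<open>By the mean value theorem, one step of the majorant pays for
  \<open>2 * ln 2 / ln (n + 1)\<close>, the amount by which the defect term drops at each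
  step.\<close>

lemma prime_pi_majorant_step:
  assumes "n \<ge> 128"
  shows "3 / 2 * real n / (ln (real n) - 1) + 2 * ln 2 / ln (real (Suc n))
           \<le> 3 / 2 * real (Suc n) / (ln (real (Suc n)) - 1)"
proof -
  have e: "exp 1 < (128::real)" using e_less_272 by linarith
  obtain t where t: "t > real n" "t < real (Suc n)" and mvt:
    "3 / 2 * real (Suc n) / (ln (real (Suc n)) - 1) - 3 / 2 * real n / (ln (real n) - 1)
       = (real (Suc n) - real n) * (3 / 2 * (ln t - 2) / (ln t - 1)\<^sup>2)"
    using MVT2[of "real n" "real (Suc n)" "\<lambda>t. 3 / 2 * t / (ln t - 1)"
        "\<lambda>t. 3 / 2 * (ln t - 2) / (ln t - 1)\<^sup>2"] prime_pi_majorant_deriv e assms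
    by (force simp del: of_nat_Suc)
  define l where "l = ln t"
  have "ln (128::real) \<le> l"
    unfolding l_def using t assms by (subst ln_le_cancel_iff) linarith+
  then have l: "l \<ge> 63 / 13" using ln_128_ge by linarith
  \<comment> \<open>Here 25/18 is an upper bound for \<open>2 * ln 2\<close>. The claim amounts to
    \<open>l * l - 2 * l \<ge> 25 / 2\<close>, which holds from about 4.68 on, hence from 63/13
    on.\<close>
  have "25 / 18 * (l - 1)\<^sup>2 \<le> 3 / 2 * (l - 2) * l"
  proof -
    have "63 / 13 * l \<le> l * l" using l by (intro mult_right_mono) auto
    moreover have "3 / 2 * (l - 2) * l - 25 / 18 * (l - 1)\<^sup>2 = 1 / 9 * (l * l) - 2 / 9 * l - 25 / 18"
      by (simp add: power2_eq_square field_simps)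
    ultimately show ?thesis using l by linarith
  qed
  moreover have "2 * ln 2 \<le> (25 / 18 :: real)" using ln2_le_25_over_36 by linarith
  ultimately have "2 * ln 2 * (l - 1)\<^sup>2 \<le> 3 / 2 * (l - 2) * l"
    by (smt (verit) mult_right_mono zero_le_power2)
  then have "2 * ln 2 / l \<le> 3 / 2 * (l - 2) / (l - 1)\<^sup>2"
    using l by (simp add: field_simps)
  moreover have "l \<le> ln (real (Suc n))"
    unfolding l_def using t assms by (subst ln_le_cancel_iff) linarith+
  then have "2 * ln 2 / ln (real (Suc n)) \<le> 2 * ln 2 / l"
    using l assms by (intro divide_left_mono mult_pos_pos) auto
  ultimately show ?thesis using mvt l_def by simp
qed

lemma ln_primorial_le: "ln (real (primorial n)) \<le> 2 * ln 2 * real n"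
proof -
  have "real (primorial n) \<le> real (4 ^ n)"
    using primorial_le by (rule of_nat_mono)
  then have "ln (real (primorial n)) \<le> ln (4 ^ n)"
    using primorial_pos[of n] by (subst ln_le_cancel_iff) auto
  also have "\<dots> = 2 * ln 2 * real n"
    using ln_realpow[of 2 2] by (simp add: ln_realpow)
  finally show ?thesis .
qed

text \<open>Partial summation turns the bound on \<open>ln (primorial n)\<close> into one on the
  number of primes; keeping the (nonpositive) defect in the estimate makes the induction work.\<close>

lemma prime_pi_le_nat_aux:
  assumes "n \<ge> 128"
  shows "real (prime_pi (real n)) \<le> 3 / 2 * real n / (ln (real n) - 1)
           + (ln (real (primorial n)) - 2 * ln 2 * real n) / ln (real n)"
  using assms
proof (induction n rule: nat_induct_at_least)
  case base
  have "real (2 ^ 160) \<le> real (primorial 128)"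
    using primorial_128 by (rule of_nat_mono)
  then have "ln (2 ^ 160) \<le> ln (real (primorial 128))"
    using primorial_pos[of 128] by (subst ln_le_cancel_iff) auto
  then have "160 * ln 2 \<le> ln (real (primorial 128))" by (simp only: ln_realpow)
  \<comment> \<open>The numerator is at least \<open>(160 - 256) * ln 2\<close>, and
    \<open>ln 2\<close> cancels against \<open>ln 128 = 7 * ln 2\<close>.\<close>
  then have "(ln (real (primorial 128)) - 2 * ln 2 * real 128) / ln (real 128) \<ge> - 96 / 7"
    by (simp add: ln_128 field_simps)
  moreover have "192 / (7 * (25 / 36) - 1) \<le> 192 / (7 * ln 2 - 1 :: real)"
    using ln2_le_25_over_36 ln2_ge_two_thirds
    by (intro divide_left_mono mult_pos_pos) linarith+
  then have "3 / 2 * real 128 / (ln (real 128) - 1) \<ge> 192 / (7 * (25 / 36) - 1)"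
    by (simp add: ln_128)
  ultimately show ?case by (simp add: prime_pi_128)
next
  case (Suc n)
  define B where "B = ln (real (primorial n)) - 2 * ln 2 * real n"
  have B: "B \<le> 0" unfolding B_def using ln_primorial_le[of n] by simp
  have pos: "0 < ln (real n)" "ln (real n) \<le> ln (real (Suc n))" using Suc.hyps by auto
  \<comment> \<open>Since \<open>B\<close> is nonpositive, enlarging the denominator increases the
    quotient.\<close>
  have "B / ln (real n) \<le> B / ln (real (Suc n))"
    using B pos by (intro divide_left_mono_neg mult_pos_pos) linarith+
  \<comment> \<open>A prime \<open>Suc n\<close> contributes \<open>ln (Suc n)\<close>, which after
    division is exactly the jump 1 of \<open>prime_pi\<close>.\<close>
  moreover have "ln (real (primorial (Suc n))) - 2 * ln 2 * real (Suc n)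
      = B - 2 * ln 2 + (if prime (Suc n) then ln (real (Suc n)) else 0)"
    using primorial_pos[of n]
    by (simp add: primorial_Suc B_def ln_mult right_diff_distrib distrib_left del: of_nat_Suc mult_Suc) (simp add: algebra_simps)
  then have "(ln (real (primorial (Suc n))) - 2 * ln 2 * real (Suc n)) / ln (real (Suc n))
      = (B - 2 * ln 2) / ln (real (Suc n)) + (if prime (Suc n) then 1 else 0)"
    using pos by (simp add: add_divide_distrib del: of_nat_Suc)
  ultimately show ?case
    using Suc.IH prime_pi_majorant_step[OF Suc.hyps]
    unfolding prime_pi_Suc B_def by (simp add: diff_divide_distrib del: of_nat_Suc)
qed

lemma prime_pi_le:
  assumes "x \<ge> 128"
  shows "real (prime_pi x) \<le> 3 / 2 * x / (ln x - 1)"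
proof -
  define n where "n = nat \<lfloor>x\<rfloor>"
  have n: "n \<ge> 128" "real n \<le> x"
    using assms unfolding n_def by (auto simp: le_nat_iff le_floor_iff)
  have "real (prime_pi x) = real (prime_pi (real n))"
    unfolding n_def using assms by (subst prime_pi_eq_floor) simp_all
  also have "\<dots> \<le> 3 / 2 * real n / (ln (real n) - 1)
           + (ln (real (primorial n)) - 2 * ln 2 * real n) / ln (real n)"
    using n(1) by (rule prime_pi_le_nat_aux)
  also have "(ln (real (primorial n)) - 2 * ln 2 * real n) / ln (real n) \<le> 0"
    using ln_primorial_le[of n] n(1) by (intro divide_nonpos_pos) auto
  \<comment> \<open>The majorant increases as long as \<open>ln t \<ge> 2\<close>, which carries the
    bound from the floor to \<open>x\<close>.\<close>
  also have "3 / 2 * real n / (ln (real n) - 1) \<le> 3 / 2 * x / (ln x - 1)"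
  proof (rule DERIV_nonneg_imp_nondecreasing[OF n(2)])
    fix t assume "real n \<le> t"
    then have t: "t \<ge> 128" using n(1) by linarith
    then have "ln 128 \<le> ln t" by (subst ln_le_cancel_iff) auto
    with ln_128_ge have "0 \<le> 3 / 2 * (ln t - 2) / (ln t - 1)\<^sup>2" by simp
    moreover have "t > exp 1" using t e_less_272 by linarith
    ultimately show "\<exists>y. ((\<lambda>t. 3 / 2 * t / (ln t - 1)) has_real_derivative y) (at t) \<and> 0 \<le> y"
      using prime_pi_majorant_deriv by blast
  qed
  finally show ?thesis by simp
qed

section \<open>Comparison of the prime count with \<open>li\<close> at critical points\<close>

lemma exp_1_ge: "exp 1 \<ge> (13 / 5 :: real)"
proof -
  \<comment> \<open>13/8 is the quadratic Taylor polynomial of \<open>exp\<close> at 1/2.\<close>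
  have "(13 / 8)\<^sup>2 \<le> (exp (1 / 2 :: real))\<^sup>2"
    using exp_lower_Taylor_quadratic[of "1 / 2 :: real"]
    by (intro power_mono) (simp_all add: power2_eq_square)
  also have "\<dots> = exp 1" by (simp flip: exp_double)
  finally show ?thesis by (simp add: power2_eq_square)
qed

text \<open>A weak Stirling bound: a single term of the exponential series is at most its
  sum.\<close>

lemma power_self_le_exp_fact: "real k ^ k \<le> exp (real k) * fact k"
proof -
  have "(\<Sum>n\<in>{k}. real k ^ n /\<^sub>R fact n) \<le> exp (real k)"
    unfolding exp_def using summable_exp_generic[of "real k"]
    by (intro sum_le_suminf) auto
  then show ?thesis by (simp add: field_simps)
qed

lemma fact_le_fact_mult_power:
  assumes "i \<le> k"
  shows "(fact k :: real) \<le> fact (k - i) * real k ^ i"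
  using assms
proof (induction i)
  case (Suc i)
  then have eq: "k - i = Suc (k - Suc i)" by simp
  have "(fact k :: real) \<le> fact (k - i) * real k ^ i" using Suc by simp
  also have "fact (k - i) = real (k - i) * fact (k - Suc i)"
    unfolding eq by (simp only: fact_Suc)
  also have "\<dots> * real k ^ i \<le> (real k * fact (k - Suc i)) * real k ^ i"
    by (intro mult_right_mono) auto
  finally show ?case by (simp add: mult_ac)
qed simp

text \<open>\<open>L\<close> is the \<open>k\<close>-th root of \<open>fact k\<close>; comparing
  \<open>k\<close>-th powers bounds it without computing roots.\<close>

lemma le_if_power_le_fact:
  fixes L q :: real
  assumes "0 < L" "k \<ge> 1" "L ^ k = fact k"
  shows "0 \<le> q \<Longrightarrow> fact k \<le> q ^ k \<Longrightarrow> L \<le> q"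
    and "0 \<le> q \<Longrightarrow> q ^ k \<le> fact k \<Longrightarrow> q \<le> L"
  using assms power_mono_iff[of L q k] power_mono_iff[of q L k] by auto

text \<open>Below, \<open>k\<close> and \<open>L\<close> with \<open>L ^ k = fact k\<close> parametrise the critical points \<open>exp L\<close> of
  \<open>\<lambda>n. li n k\<close>.\<close>

lemma prime_pi_less_critical_small:
  fixes L q :: real and r :: nat
  assumes L: "0 < L" "k \<ge> 1" "L ^ k = fact k"
    and q: "0 \<le> q" "fact k \<le> q ^ k" and r: "real r ^ k \<le> fact k"
    and ineq: "1 / 3 + 5 / (3 * (13 / 5) ^ r) < (\<Sum>j<k. fact j / q ^ Suc j)"
  shows "real (prime_pi (exp L)) < exp L * (\<Sum>j<k. fact j / L ^ Suc j)"
proof -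
  \<comment> \<open>The upper bound \<open>q\<close> for \<open>L\<close> bounds the sum from below;
    the lower bound \<open>r\<close> controls the error \<open>5 / (3 * exp L)\<close> coming from
    \<open>prime_pi_le_third\<close>.\<close>
  have Lq: "L \<le> q" and rL: "real r \<le> L"
    using le_if_power_le_fact[OF L] q r by auto
  have "(13 / 5) ^ r \<le> (exp 1 :: real) ^ r"
    using exp_1_ge by (intro power_mono) auto
  also have "\<dots> = exp (real r)" by (simp flip: exp_of_nat_mult)
  also have "\<dots> \<le> exp L" using rL by simp
  finally have "5 / (3 * exp L) \<le> 5 / (3 * (13 / 5) ^ r)"
    by (intro divide_left_mono) auto
  moreover have "(\<Sum>j<k. fact j / q ^ Suc j) \<le> (\<Sum>j<k. fact j / L ^ Suc j)"
    using Lq L(1) by (intro sum_mono divide_left_mono power_mono mult_pos_pos zero_less_power) auto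
  ultimately have "1 / 3 + 5 / (3 * exp L) < (\<Sum>j<k. fact j / L ^ Suc j)"
    using ineq by linarith
  then have "exp L * (1 / 3 + 5 / (3 * exp L)) < exp L * (\<Sum>j<k. fact j / L ^ Suc j)"
    by simp
  moreover have "exp L * (1 / 3 + 5 / (3 * exp L)) = (exp L + 5) / 3"
    by (simp add: field_simps)
  moreover have "real (prime_pi (exp L)) \<le> (exp L + 5) / 3"
    using L(1) by (intro prime_pi_le_third) simp
  ultimately show ?thesis by linarith
qed

text \<open>This gives \<open>L \<ge> 6\<close>; 14 is the least positive exponent for which it
  holds.\<close>

lemma six_power_le_fact:
  assumes "k \<ge> 14"
  shows "(6::real) ^ k \<le> fact k"
  using assms
proof (induction k rule: nat_induct_at_least)
  case base
  show ?case by (simp add: fact_numeral)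
next
  case (Suc n)
  then have "6 * 6 ^ n \<le> real (Suc n) * fact n"
    by (intro mult_mono) auto
  then show ?case by simp
qed

text \<open>As \<open>L / k\<close> is at least \<open>1 / e\<close>, the last terms of the sum add up to nearly
  \<open>1 / (e - 1)\<close>, so that together with the first term they exceed \<open>3 / 2\<close>.\<close>

lemma critical_sum_ge:
  fixes L :: real
  assumes L: "0 < L" "k \<ge> 14" "L ^ k = fact k"
  shows "(\<Sum>j<k. fact j / L ^ j) \<ge> 1 + 1 / L + 2 / L\<^sup>2 + 6 / L ^ 3 + 57 / 100"
proof -
  let ?a = "\<lambda>j. fact j / L ^ j"
  let ?g = "\<lambda>i. k - i"
  have k: "real k > 0" using L(2) by simp
  have "(real k / exp 1) ^ k \<le> fact k"
    using power_self_le_exp_fact[of k]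
    by (simp add: power_divide divide_le_eq mult.commute flip: exp_of_nat_mult)
  then have "real k / exp 1 \<le> L"
    using L by (intro le_if_power_le_fact(2)[of L k]) auto
  then have "1 / exp 1 \<le> L / real k"
    using k by (simp add: field_simps)
  moreover have "(100 / 272 :: real) \<le> 1 / exp 1"
    using e_less_272 by (simp add: field_simps)
  ultimately have x: "100 / 272 \<le> L / real k" by linarith
  \<comment> \<open>As \<open>?a k = 1\<close>, going down \<open>i\<close> indices gives
    \<open>L ^ i\<close> divided by \<open>i\<close> factors that are at most \<open>k\<close>,
    hence at least \<open>(L / k) ^ i\<close>.\<close>
  have tail: "(100 / 272) ^ i \<le> ?a (?g i)" if "i \<in> {1..5}" for i
  proof -
    have i: "i \<le> k" using that L(2) by simp
    have "(100 / 272) ^ i \<le> (L / real k) ^ i" using x by (intro power_mono) auto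
    also have "\<dots> = L ^ k / (L ^ (k - i) * real k ^ i)"
      using i L(1) by (simp add: power_divide power_diff)
    also have "\<dots> \<le> fact (k - i) * real k ^ i / (L ^ (k - i) * real k ^ i)"
      using fact_le_fact_mult_power[OF i] L(1,3) by (intro divide_right_mono) auto
    also have "\<dots> = ?a (?g i)" using k by simp
    finally show ?thesis .
  qed
  have inj: "inj_on ?g {1..5}" using L(2) by (auto intro!: inj_onI)
  \<comment> \<open>Five terms already come close to the full geometric series, about 0.581.\<close>
  have "57 / 100 \<le> (\<Sum>i\<in>{1..5::nat}. (100 / 272) ^ i :: real)"
    by (simp add: eval_nat_numeral)
  also have "\<dots> \<le> (\<Sum>i\<in>{1..5}. ?a (?g i))"
    using tail by (rule sum_mono)
  also have "\<dots> = sum ?a (?g ` {1..5})"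
    using inj by (simp add: sum.reindex)
  \<comment> \<open>The first four and the last five indices are disjoint because
    \<open>k \<ge> 14\<close>.\<close>
  finally have "sum ?a {..<4} + 57 / 100 \<le> sum ?a {..<4} + sum ?a (?g ` {1..5})" by simp
  also have "\<dots> = sum ?a ({..<4} \<union> ?g ` {1..5})"
    using L(2) by (intro sum.union_disjoint[symmetric]) auto
  also have "\<dots> \<le> sum ?a {..<k}"
    using L(1,2) by (intro sum_mono2) auto
  also have "sum ?a {..<4} = 1 + 1 / L + 2 / L\<^sup>2 + 6 / L ^ 3"
    by (simp add: eval_nat_numeral)
  finally show ?thesis .
qed

lemma prime_pi_less_critical_large:
  fixes L :: real
  assumes L: "0 < L" "k \<ge> 14" "L ^ k = fact k"
  shows "real (prime_pi (exp L)) < exp L * (\<Sum>j<k. fact j / L ^ Suc j)"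
proof -
  have L6: "L \<ge> 6"
    using L six_power_le_fact by (intro le_if_power_le_fact(2)[of L k]) auto
  have "(13 / 5) ^ 6 \<le> (exp 1 :: real) ^ 6"
    using exp_1_ge by (intro power_mono) auto
  also have "\<dots> = exp 6" by (simp flip: exp_of_nat_mult)
  also have "\<dots> \<le> exp L" using L6 by simp
  finally have "exp L \<ge> 128" by (simp add: eval_nat_numeral)
  then have "real (prime_pi (exp L)) \<le> 3 / 2 * exp L / (L - 1)"
    using prime_pi_le[of "exp L"] by simp
  also have "\<dots> = exp L / L * (3 / 2 * L / (L - 1))" using L(1) by simp
  also have "\<dots> < exp L / L * (1 + 1 / L + 2 / L\<^sup>2 + 6 / L ^ 3 + 57 / 100)"
  proof (rule mult_strict_left_mono)
    \<comment> \<open>The product is \<open>7 * L\<^sup>2 - 57 * L + 90\<close>, leaving a slack of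
      10 in the quadratic that appears after clearing denominators.\<close>
    have "(L - 6) * (7 * L - 15) \<ge> 0" using L6 by (intro mult_nonneg_nonneg) auto
    then have "7 * L\<^sup>2 - 57 * L + 100 > 0" using L6 by (simp add: power2_eq_square algebra_simps)
    then have "L\<^sup>2 * (7 * L\<^sup>2 - 57 * L + 100) > 0"
      using L6 by (intro mult_pos_pos) auto
    moreover have "100 * (4 * L - 6) > 0" using L6 by simp
    ultimately have "L\<^sup>2 * (7 * L\<^sup>2 - 57 * L + 100) + 100 * (4 * L - 6) > 0"
      by (rule add_pos_pos)
    moreover have "(L ^ 3 + L\<^sup>2 + 2 * L + 6 + 57 / 100 * L ^ 3) * (L - 1) - 3 / 2 * L * L ^ 3
        = (L\<^sup>2 * (7 * L\<^sup>2 - 57 * L + 100) + 100 * (4 * L - 6)) / 100"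
      by (simp add: power2_eq_square power3_eq_cube field_simps)
    ultimately have "0 < (L ^ 3 + L\<^sup>2 + 2 * L + 6 + 57 / 100 * L ^ 3) * (L - 1) - 3 / 2 * L * L ^ 3"
      by (simp only: zero_less_divide_iff) simp
    then have "3 / 2 * L * L ^ 3 < (L ^ 3 + L\<^sup>2 + 2 * L + 6 + 57 / 100 * L ^ 3) * (L - 1)"
      by (simp only: diff_gt_0_iff_gt)
    then have "3 / 2 * L / (L - 1) < (L ^ 3 + L\<^sup>2 + 2 * L + 6 + 57 / 100 * L ^ 3) / L ^ 3"
      using L6 by (simp add: divide_less_eq less_divide_eq field_simps)
    also have "\<dots> = 1 + 1 / L + 2 / L\<^sup>2 + 6 / L ^ 3 + 57 / 100"
      using L6 by (simp add: add_divide_distrib power2_eq_square power3_eq_cube)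
    finally show "3 / 2 * L / (L - 1) < 1 + 1 / L + 2 / L\<^sup>2 + 6 / L ^ 3 + 57 / 100" .
  qed (use L in simp)
  also have "\<dots> \<le> exp L / L * (\<Sum>j<k. fact j / L ^ j)"
    using critical_sum_ge[OF L] L(1) by (intro mult_left_mono) auto
  also have "\<dots> = exp L * (\<Sum>j<k. fact j / L ^ Suc j)"
    by (simp add: sum_distrib_left sum_divide_distrib mult.commute)
  finally show ?thesis .
qed

lemma prime_pi_less_critical:
  fixes L :: real
  assumes L: "0 < L" "k \<ge> 1" "L ^ k = fact k"
  shows "real (prime_pi (exp L)) < exp L * (\<Sum>j<k. fact j / L ^ Suc j)"
proof -
  note small = prime_pi_less_critical_small[OF L]
  consider "k \<ge> 14" | "k \<in> {1..13}" using L(2) by fastforce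
  then show ?thesis
  proof cases
    case 1
    then show ?thesis using prime_pi_less_critical_large L by blast
  next
    case 2
    then have "k \<in> {1,2,3,4,5,6,7,8,9,10,11,12,13}"
      by (auto simp: eval_nat_numeral le_Suc_eq)
    then show ?thesis
      \<comment> \<open>In each case \<open>q\<close> is the \<open>k\<close>-th root of
        \<open>fact k\<close> rounded up to two decimals, and \<open>r\<close> is its integer
        part.\<close>
      apply (elim insertE emptyE)
      subgoal by (rule small[of 1 1]) (simp_all add: eval_nat_numeral)
      subgoal by (rule small[of "142/100" 1]) (simp_all add: eval_nat_numeral)
      subgoal by (rule small[of "182/100" 1]) (simp_all add: eval_nat_numeral)
      subgoal by (rule small[of "222/100" 2]) (simp_all add: eval_nat_numeral)
      subgoal by (rule small[of "261/100" 2]) (simp_all add: eval_nat_numeral)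
      subgoal by (rule small[of "3" 2]) (simp_all add: eval_nat_numeral)
      subgoal by (rule small[of "339/100" 3]) (simp_all add: eval_nat_numeral)
      subgoal by (rule small[of "377/100" 3]) (simp_all add: eval_nat_numeral)
      subgoal by (rule small[of "415/100" 4]) (simp_all add: eval_nat_numeral)
      subgoal by (rule small[of "453/100" 4]) (simp_all add: eval_nat_numeral)
      subgoal by (rule small[of "491/100" 4]) (simp_all add: eval_nat_numeral)
      subgoal by (rule small[of "529/100" 5]) (simp_all add: eval_nat_numeral)
      subgoal by (rule small[of "567/100" 5]) (simp_all add: eval_nat_numeral)
      done
  qed
qed

subsection \<open>The parametric logarithmic operator\<close>

lemma phi_0 [simp]: "phi 0 = 0" and phi_1 [simp]: "phi 1 = 1"
  by (simp_all add: phi_def)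

text \<open>This symmetry transfers the flatness of \<open>phi\<close> at 0 to the other end of the
  unit interval.\<close>

lemma phi_compl: "phi (1 - x) = 1 - phi x"
  unfolding phi_def by algebra

lemma phi_has_derivative: "(phi has_real_derivative 140 * x ^ 3 * (1 - x) ^ 3) (at x)"
  unfolding phi_def [abs_def]
  by (rule derivative_eq_intros refl)+ (simp add: eval_nat_numeral algebra_simps)

lemma continuous_on_phi: "continuous_on A phi"
  unfolding phi_def [abs_def] by (intro continuous_intros)

lemma phi_strict_mono:
  assumes "0 \<le> x" "x < y" "y \<le> 1"
  shows "phi x < phi y"
proof (rule DERIV_pos_imp_increasing_open[OF assms(2) _ continuous_on_phi])
  fix t assume "x < t" "t < y"
  then have "0 < 140 * t ^ 3 * (1 - t) ^ 3" using assms by simp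
  then show "\<exists>d. (phi has_real_derivative d) (at t) \<and> 0 < d"
    using phi_has_derivative by blast
qed

lemma phi_nonneg: "0 \<le> x \<Longrightarrow> x \<le> 1 \<Longrightarrow> 0 \<le> phi x"
  using phi_strict_mono[of 0 x] by (cases "x = 0") auto

text \<open>The difference is \<open>x ^ 5\<close> times a quadratic that is positive on the unit
  interval.\<close>

lemma phi_le:
  assumes "0 \<le> x" "x \<le> 1"
  shows "phi x \<le> 35 * x ^ 4"
proof -
  have "0 \<le> 84 - 70 * x + 20 * x\<^sup>2" using assms by (intro add_nonneg_nonneg) auto
  then have "0 \<le> x ^ 5 * (84 - 70 * x + 20 * x\<^sup>2)" using assms by (intro mult_nonneg_nonneg) auto
  also have "\<dots> = 35 * x ^ 4 - phi x"
    unfolding phi_def by algebra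
  finally show ?thesis by simp
qed

text \<open>The right endpoint is included although the floor jumps there: \<open>phi 1 = 1\<close>
  supplies exactly the term that the longer sum gains. So \<open>li\<close> can be treated on closed
  blocks that share endpoints.\<close>

lemma li_eq:
  assumes "real k \<le> \<tau>" "\<tau> \<le> real k + 1"
  shows "li n \<tau> = n / ln n * ((\<Sum>j<k. fact j / ln n ^ j) + phi (\<tau> - real k) * (fact k / ln n ^ k))"
proof (cases "\<tau> = real k + 1")
  case True
  then have "\<tau> = real (Suc k)" by simp
  then have "\<lfloor>\<tau>\<rfloor> = int (Suc k)" by (simp only: floor_of_nat)
  then have eq: "nat \<lfloor>\<tau>\<rfloor> = Suc k" "frac \<tau> = 0"
    unfolding frac_def using True by simp_all
  show ?thesis unfolding li_def Let_def eq using True by simp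
next
  case False
  then have "\<lfloor>\<tau>\<rfloor> = int k" using assms by linarith
  then show ?thesis by (simp add: li_def frac_def)
qed

lemma li_of_nat: "li n (real k) = n * (\<Sum>j<k. fact j / ln n ^ Suc j)"
  by (simp add: li_eq[of k] sum_distrib_left sum_divide_distrib)

lemma li_0 [simp]: "li n 0 = 0"
  using li_of_nat[of n 0] by simp

lemma li_strict_mono_block:
  assumes "n > 1" "real k \<le> s" "s < t" "t \<le> real k + 1"
  shows "li n s < li n t"
proof -
  have "phi (s - real k) < phi (t - real k)"
    using assms by (intro phi_strict_mono) auto
  then have "n / ln n * ((\<Sum>j<k. fact j / ln n ^ j) + phi (s - real k) * (fact k / ln n ^ k))
      < n / ln n * ((\<Sum>j<k. fact j / ln n ^ j) + phi (t - real k) * (fact k / ln n ^ k))"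
    using assms(1)
    by (intro mult_strict_left_mono add_strict_left_mono mult_strict_right_mono) auto
  then show ?thesis
    using li_eq[of k s n] li_eq[of k t n] assms by argo
qed

lemma li_strict_mono:
  assumes "n > 1" "0 \<le> s" "s < t"
  shows "li n s < li n t"
proof -
  define a b where "a = nat \<lfloor>s\<rfloor>" and "b = nat \<lfloor>t\<rfloor>"
  have a: "real a \<le> s" "s < real a + 1" and b: "real b \<le> t" "t < real b + 1"
    using assms unfolding a_def b_def by linarith+
  show ?thesis
  proof (cases "t \<le> real a + 1")
    case True
    then show ?thesis using a assms by (intro li_strict_mono_block[of n a]) auto
  next
    case False
    have step: "li n (real i) \<le> li n (real (Suc i))" for i
      using li_strict_mono_block[of n i "real i" "real (Suc i)"] assms(1) by simp
    have "li n s < li n (real (Suc a))"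
      using a assms(1) by (intro li_strict_mono_block[of n a]) auto
    also have "\<dots> \<le> li n (real b)"
      using False b by (intro lift_Suc_mono_le[of "\<lambda>i. li n (real i)", OF step]) linarith
    also have "\<dots> \<le> li n t"
      using b assms(1) li_strict_mono_block[of n b "real b" t] by (cases "t = real b") auto
    finally show ?thesis .
  qed
qed

section \<open>Existence and uniqueness of the truncation parameter\<close>

lemma li_le_cancel:
  assumes "n > 1" "0 \<le> s" "0 \<le> t"
  shows "li n s \<le> li n t \<longleftrightarrow> s \<le> t"
  using li_strict_mono[OF assms(1,2), of t] li_strict_mono[OF assms(1,3), of s]
  by (cases s t rule: linorder_cases) auto

text \<open>The terms of the exponential series tend to 0, so their reciprocals
  \<open>fact j / ln n ^ j\<close> are unbounded, and one of them suffices.\<close>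

lemma li_unbounded:
  assumes "n > 1"
  shows "\<exists>k. c \<le> li n (real k)"
proof -
  let ?L = "ln n"
  have L: "?L > 0" using assms by simp
  have "(\<lambda>j. inverse (fact j) * ?L ^ j) \<longlonglongrightarrow> 0"
    by (rule summable_LIMSEQ_zero[OF summable_exp])
  then have "eventually (\<lambda>j. inverse (fact j) * ?L ^ j < n / ?L / (\<bar>c\<bar> + 1)) sequentially"
    using assms L by (intro order_tendstoD(2)) (auto intro!: divide_pos_pos)
  then obtain j where j: "inverse (fact j) * ?L ^ j < n / ?L / (\<bar>c\<bar> + 1)"
    by (auto simp: eventually_sequentially)
  define x where "x = inverse (fact j) * ?L ^ j"
  have "x > 0" using L by (simp add: x_def)
  have "x * (\<bar>c\<bar> + 1) < n / ?L"
    using j pos_less_divide_eq[of "\<bar>c\<bar> + 1" x "n / ?L"] unfolding x_def by linarith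
  then have "\<bar>c\<bar> + 1 < n / ?L / x" using \<open>x > 0\<close> by (simp only: pos_less_divide_eq mult.commute)
  also have "\<dots> = n / ?L * (fact j / ?L ^ j)"
    by (simp add: x_def field_simps)
  also have "n / ?L * (fact j / ?L ^ j) \<le> n / ?L * (\<Sum>i<Suc j. fact i / ?L ^ i)"
    using L assms by (intro mult_left_mono member_le_sum) auto
  also have "\<dots> = li n (real (Suc j))"
    using li_eq[of "Suc j" "real (Suc j)" n] by simp
  finally show ?thesis by (intro exI[of _ "Suc j"]) linarith
qed

text \<open>The intermediate value theorem is applied on the first block whose right end reaches
  \<open>c\<close>, where \<open>li_eq\<close> gives a polynomial in \<tau>.\<close>

lemma li_ex1:
  assumes "n > 1" "c > 0"
  shows "\<exists>!\<tau>. 0 < \<tau> \<and> li n \<tau> = c"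
proof -
  define k where "k = (LEAST k. c \<le> li n (real k))"
  have k: "c \<le> li n (real k)"
    unfolding k_def using li_unbounded[OF assms(1)] by (rule LeastI_ex)
  have "k \<noteq> 0" using k assms(2) by (intro notI) simp
  then obtain m where m: "k = Suc m" by (cases k) auto
  have "\<not> c \<le> li n (real m)"
    using not_less_Least[of m "\<lambda>k. c \<le> li n (real k)"] m by (simp add: k_def)
  moreover have "continuous_on {real m..real k} (li n)"
  proof (subst continuous_on_cong[OF refl li_eq[of m]])
    show "continuous_on {real m..real k} (\<lambda>\<tau>. n / ln n *
        ((\<Sum>j<m. fact j / ln n ^ j) + phi (\<tau> - real m) * (fact m / ln n ^ m)))"
      by (intro continuous_intros continuous_on_compose2[OF continuous_on_phi[of UNIV]]) auto
  qed (use m in auto)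
  ultimately obtain \<tau> where t: "real m \<le> \<tau>" "li n \<tau> = c"
    using IVT'[of "li n" "real m" c "real k"] k m by auto
  moreover have "\<tau> \<noteq> 0" using t(2) assms(2) by auto
  ultimately have "0 < \<tau> \<and> li n \<tau> = c" by linarith
  moreover have "\<sigma> = \<tau>" if "0 < \<sigma> \<and> li n \<sigma> = c" for \<sigma>
    using that calculation li_le_cancel[OF assms(1), of \<sigma> \<tau>] li_le_cancel[OF assms(1), of \<tau> \<sigma>] by simp
  ultimately show ?thesis by blast
qed

lemma prime_pi_pos:
  assumes "x \<ge> 2"
  shows "prime_pi x > 0"
proof -
  have "{p::nat. prime p \<and> real p \<le> x} \<subseteq> {..nat \<lfloor>x\<rfloor>}" by (auto simp: le_nat_floor)
  then have "finite {p::nat. prime p \<and> real p \<le> x}" by (rule finite_subset) simp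
  moreover have "2 \<in> {p::nat. prime p \<and> real p \<le> x}" using assms by simp
  ultimately show ?thesis unfolding prime_pi_def card_gt_0_iff by blast
qed

lemma tau_pi_ex1:
  assumes "n \<ge> 2"
  shows "\<exists>!\<tau>. 0 < \<tau> \<and> li n \<tau> = real (prime_pi n)"
  using assms prime_pi_pos[OF assms] by (intro li_ex1) auto

lemma tau_pi:
  assumes "n \<ge> 2"
  shows "0 < tau_pi n" "li n (tau_pi n) = real (prime_pi n)"
  using theI'[OF tau_pi_ex1[OF assms]] unfolding tau_pi_def by auto

section \<open>Variation of \<open>li\<close> in \<open>n\<close>, and near integer
  parameters\<close>

lemma isCont_li: "n > 1 \<Longrightarrow> isCont (\<lambda>n. li n \<tau>) n"
  unfolding li_def Let_def by (intro continuous_intros) auto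

text \<open>The derivative telescopes: the negative part produced by one summand cancels the
  positive part of the next.\<close>

lemma li_has_derivative:
  assumes "n > 1"
  shows "((\<lambda>n. li n (real k)) has_real_derivative 1 / ln n - fact k / ln n ^ Suc k) (at n)"
proof (induction k)
  case 0
  show ?case by simp
next
  case (Suc k)
  have L: "ln n > 0" using assms by simp
  have "((\<lambda>n. ln n ^ Suc k) has_real_derivative real (Suc k) * (1 / n * ln n ^ k)) (at n)"
    using DERIV_power[OF DERIV_ln_divide[of n], of "Suc k"] assms by (simp del: power_Suc)
  then have "((\<lambda>n. fact k / ln n ^ Suc k) has_real_derivative
      (0 * ln n ^ Suc k - fact k * (real (Suc k) * (1 / n * ln n ^ k))) / (ln n ^ Suc k * ln n ^ Suc k)) (at n)"
    using L by (intro DERIV_divide DERIV_const) auto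
  from DERIV_mult[OF DERIV_ident this]
  have "((\<lambda>n. n * (fact k / ln n ^ Suc k)) has_real_derivative
      1 * (fact k / ln n ^ Suc k) + (0 * ln n ^ Suc k - fact k * (real (Suc k) * (1 / n * ln n ^ k)))
        / (ln n ^ Suc k * ln n ^ Suc k) * n) (at n)" .
  also have "1 * (fact k / ln n ^ Suc k) + (0 * ln n ^ Suc k - fact k * (real (Suc k) * (1 / n * ln n ^ k)))
        / (ln n ^ Suc k * ln n ^ Suc k) * n
      = fact k / ln n ^ Suc k - fact (Suc k) / ln n ^ Suc (Suc k)"
    using assms L by (simp add: divide_simps) (simp add: algebra_simps)?
  finally have "((\<lambda>n. li n (real k) + n * (fact k / ln n ^ Suc k)) has_real_derivative
      1 / ln n - fact k / ln n ^ Suc k + (fact k / ln n ^ Suc k - fact (Suc k) / ln n ^ Suc (Suc k))) (at n)"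
    by (intro DERIV_add Suc.IH)
  moreover have "li n (real (Suc k)) = li n (real k) + n * (fact k / ln n ^ Suc k)" for n
    unfolding li_of_nat by (simp add: algebra_simps)
  ultimately show ?case by (simp del: fact_Suc power_Suc of_nat_Suc)
qed

text \<open>Above \<open>k\<close> the change is \<open>phi (\<tau> - k)\<close> times the term of
  index \<open>k\<close>; below, by \<open>phi_compl\<close>, it is \<open>phi (k - \<tau>)\<close>
  times the term of index \<open>k - 1\<close>. Adding both coefficients covers both sides.\<close>

lemma li_diff_le:
  assumes "n > 1" "k \<ge> 1" "\<bar>\<tau> - real k\<bar> \<le> 1"
  shows "\<bar>li n \<tau> - li n (real k)\<bar>
    \<le> n / ln n * (fact (k - 1) / ln n ^ (k - 1) + fact k / ln n ^ k) * (35 * \<bar>\<tau> - real k\<bar> ^ 4)"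
    (is "_ \<le> n / ln n * (?A + ?B) * ?d")
proof -
  have L: "ln n > 0" using assms(1) by simp
  have pos: "?A \<ge> 0" "?B \<ge> 0" "n / ln n \<ge> 0" using L assms(1) by auto
  have "\<bar>li n \<tau> - li n (real k)\<bar> \<le> n / ln n * (?A * ?d) \<or> \<bar>li n \<tau> - li n (real k)\<bar> \<le> n / ln n * (?B * ?d)"
  proof (cases "real k \<le> \<tau>")
    case True
    then have x: "0 \<le> \<tau> - real k" "\<tau> - real k \<le> 1" using assms(3) by auto
    have "li n \<tau> - li n (real k) = n / ln n * (?B * phi (\<tau> - real k))"
      using x by (simp add: li_eq[of k] algebra_simps)
    moreover have "0 \<le> n / ln n * (?B * phi (\<tau> - real k))"
      using pos phi_nonneg[OF x] by (intro mult_nonneg_nonneg)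
    moreover have "n / ln n * (?B * phi (\<tau> - real k)) \<le> n / ln n * (?B * ?d)"
      using phi_le[OF x] x pos by (intro mult_left_mono) auto
    ultimately show ?thesis by linarith
  next
    case False
    then have x: "0 \<le> real k - \<tau>" "real k - \<tau> \<le> 1" using assms(3) by auto
    obtain m where m: "k = Suc m" using assms(2) by (cases k) auto
    define P where "P = phi (real k - \<tau>)"
    have phi_P: "phi (\<tau> - real m) = 1 - P"
      using phi_compl[of "real k - \<tau>"] m by (simp add: P_def)
    have block: "real m \<le> \<tau>" "\<tau> \<le> real m + 1" using x m by simp_all
    have li_k: "li n (real k) = n / ln n * ((\<Sum>j<m. fact j / ln n ^ j) + fact m / ln n ^ m)"
      using li_eq[of m "real k" n] m by simp
    have km: "k - 1 = m" using m by simp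
    have "li n \<tau> - li n (real k) = - (n / ln n * (?A * P))"
      unfolding li_k km li_eq[OF block] phi_P by algebra
    moreover have "0 \<le> n / ln n * (?A * P)"
      unfolding P_def using pos phi_nonneg[OF x] by (intro mult_nonneg_nonneg)
    moreover have "n / ln n * (?A * P) \<le> n / ln n * (?A * ?d)"
      unfolding P_def using phi_le[OF x] x pos by (intro mult_left_mono) (auto simp: abs_minus_commute)
    ultimately show ?thesis by linarith
  qed
  moreover have "n / ln n * (?A * ?d) \<le> n / ln n * (?A + ?B) * ?d" "n / ln n * (?B * ?d) \<le> n / ln n * (?A + ?B) * ?d"
    unfolding mult.assoc by (intro mult_left_mono mult_right_mono; use pos in simp)+
  ultimately show ?thesis by linarith
qed

section \<open>Vertical tangents\<close>

lemma vertical_tangent_not_differentiable: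
  assumes "has_vertical_tangent f a"
  shows "\<not> f differentiable (at a)"
proof
  assume "f differentiable (at a)"
  then obtain d where "(f has_real_derivative d) (at a)"
    by (auto simp: real_differentiable_def)
  then have "((\<lambda>x. (f x - f a) / (x - a)) \<longlongrightarrow> d) (at a)"
    by (simp add: has_field_derivative_iff)
  moreover have "filterlim (\<lambda>x. (f x - f a) / (x - a)) at_infinity (at a)"
    using assms unfolding has_vertical_tangent_def
    by (auto intro: filterlim_at_top_imp_at_infinity filterlim_at_bot_imp_at_infinity)
  ultimately show False
    using not_tendsto_and_filterlim_at_infinity[of "at a"] by auto
qed

text \<open>Meant for \<open>f = tau_pi\<close> and \<open>g n = li n k\<close>. As \<open>g\<close>
  moves linearly and is controlled by the fourth power of the change of \<open>f\<close>, that
  change is at least of order \<open>\<bar>x - a\<bar>\<close> to the power 1/4. The opposite signs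
  fix the sign of the quotient and rule out a cusp.\<close>

lemma has_vertical_tangentI:
  fixes f g :: "real \<Rightarrow> real"
  assumes f: "isCont f a" and g: "(g has_real_derivative d) (at a)" and d: "d \<noteq> 0"
    and sgn: "eventually (\<lambda>x. (f x - f a) * (g x - g a) \<le> 0) (at a)"
    and bound: "eventually (\<lambda>x. \<bar>g x - g a\<bar> \<le> C * \<bar>f x - f a\<bar> ^ 4) (at a)"
  shows "has_vertical_tangent f a"
proof -
  define q where "q = (\<lambda>x. (g x - g a) / (x - a))"
  \<comment> \<open>The difference quotient of \<open>f\<close> is \<open>- (q / r)\<close>; the
    minus sign makes \<open>r\<close> positive, and \<open>r\<close> tends to 0 like the cube of the
    change of \<open>f\<close>.\<close>
  define r where "r = (\<lambda>x. - (g x - g a) / (f x - f a))"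
  have q: "(q \<longlongrightarrow> d) (at a)"
    using g unfolding q_def has_field_derivative_iff .
  have "eventually (\<lambda>x. q x \<noteq> 0) (at a)"
    using q d by (rule tendsto_imp_eventually_ne)
  then have ev: "eventually (\<lambda>x. x \<noteq> a \<and> f x \<noteq> f a \<and> g x \<noteq> g a \<and> 0 < r x
      \<and> \<bar>r x\<bar> \<le> C * \<bar>f x - f a\<bar> ^ 3) (at a)"
    using sgn bound
  proof eventually_elim
    case (elim x)
    then have gx: "x \<noteq> a" "g x \<noteq> g a" by (auto simp: q_def)
    with elim(3) have fx: "f x \<noteq> f a" by auto
    have "(f x - f a) * (g x - g a) < 0" using elim(2) gx fx by (simp add: less_le)
    then have "0 < r x" unfolding r_def by (auto simp: zero_less_divide_iff mult_less_0_iff)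
    moreover have "\<bar>r x\<bar> * \<bar>f x - f a\<bar> \<le> C * \<bar>f x - f a\<bar> ^ 3 * \<bar>f x - f a\<bar>"
      using elim(3) fx by (simp add: r_def abs_divide abs_minus_commute eval_nat_numeral mult_ac)
    then have "\<bar>r x\<bar> \<le> C * \<bar>f x - f a\<bar> ^ 3" using fx by (simp add: mult_le_cancel_right)
    ultimately show ?case using gx fx by blast
  qed
  have "((\<lambda>x. C * \<bar>f x - f a\<bar> ^ 3) \<longlongrightarrow> C * \<bar>f a - f a\<bar> ^ 3) (at a)"
    using f by (intro tendsto_intros) (simp add: isCont_def)
  then have "((\<lambda>x. C * \<bar>f x - f a\<bar> ^ 3) \<longlongrightarrow> 0) (at a)" by simp
  then have r0: "(r \<longlongrightarrow> 0) (at a)"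
    by (rule tendsto_0_le[where K = 1, OF _ eventually_mono[OF ev]]) auto
  have rpos: "eventually (\<lambda>x. 0 < r x) (at a)" using ev by eventually_elim simp
  have eq: "eventually (\<lambda>x. (f x - f a) / (x - a) = - (q x / r x)) (at a)"
    using ev
  proof eventually_elim
    case (elim x)
    have key: "F / X = - ((G / X) / (- G / F))" if "F \<noteq> 0" "G \<noteq> 0" "X \<noteq> 0" for F G X :: real
      using that by simp
    show ?case unfolding q_def r_def using elim by (intro key) auto
  qed
  show ?thesis
  proof (cases "d > 0")
    case True
    have "filterlim (\<lambda>x. q x / r x) at_top (at a)"
      by (rule LIM_at_top_divide[OF q True r0 rpos])
    then have "filterlim (\<lambda>x. - (q x / r x)) at_bot (at a)"
      by (simp add: filterlim_uminus_at_bot)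
    then have "filterlim (\<lambda>x. (f x - f a) / (x - a)) at_bot (at a)"
      using filterlim_cong[OF refl refl eq] by blast
    then show ?thesis using f by (simp add: has_vertical_tangent_def)
  next
    case False
    then have "- d > 0" using d by simp
    then have "filterlim (\<lambda>x. - q x / r x) at_top (at a)"
      by (rule LIM_at_top_divide[OF tendsto_minus[OF q] _ r0 rpos])
    then have "filterlim (\<lambda>x. (f x - f a) / (x - a)) at_top (at a)"
      using filterlim_cong[OF refl refl eq, of at_top] by simp
    then show ?thesis using f by (simp add: has_vertical_tangent_def)
  qed
qed

section \<open>Continuity and tangents of \<open>tau_pi\<close>\<close>

lemma tau_pi_isCont:
  assumes S: "open S" "\<And>n. n \<in> S \<Longrightarrow> n \<ge> 2 \<and> prime_pi n = m" and a: "a \<in> S"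
  shows "isCont tau_pi a"
  unfolding isCont_def
proof (rule order_tendstoI)
  have inS: "eventually (\<lambda>n. n \<in> S) (at a)"
    using S(1) a by (rule eventually_at_in_open')
  have a2: "a > 1" using S(2)[OF a] by simp
  \<comment> \<open>By monotonicity in \<tau>, comparing \<open>tau_pi n\<close> with a fixed
    \<open>t \<ge> 0\<close> means comparing the constant \<open>m\<close> with
    \<open>li n t\<close>, which is continuous in \<open>n\<close>.\<close>
  have lim: "((\<lambda>n. li n t) \<longlongrightarrow> li a t) (at a)" for t
    using isCont_li[OF a2] by (simp add: isCont_def)
  note tau = tau_pi[OF conjunct1[OF S(2)]]
  {
    fix t assume t: "t < tau_pi a"
    show "eventually (\<lambda>n. t < tau_pi n) (at a)"
    proof (cases "t < 0")
      case True
      show ?thesis using inS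
        by eventually_elim (use True tau(1) in force)
    next
      case False
      then have "li a t < real m"
        using li_strict_mono[OF a2 _ t] tau(2)[OF a] S(2)[OF a] by simp
      then have "eventually (\<lambda>n. li n t < real m) (at a)"
        using lim order_tendstoD(2) by blast
      then show ?thesis using inS
      proof eventually_elim
        case (elim n)
        then show ?case
          using li_le_cancel[of n "tau_pi n" t] tau[of n] S(2)[of n] False by auto
      qed
    qed
  next
    fix t assume t: "tau_pi a < t"
    have tpos: "0 < t" using tau(1)[OF a] t by linarith
    have "real m < li a t"
      using li_strict_mono[OF a2 _ t] tau[OF a] S(2)[OF a] by simp
    then have "eventually (\<lambda>n. real m < li n t) (at a)"
      using lim order_tendstoD(1) by blast
    then show "eventually (\<lambda>n. tau_pi n < t) (at a)" using inS
    proof eventually_elim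
      case (elim n)
      then show ?case
        using li_le_cancel[of n t "tau_pi n"] tau[of n] S(2)[of n] tpos by auto
    qed
  }
qed

text \<open>On \<open>S\<close> the value \<open>li n (tau_pi n)\<close> is constantly
  \<open>m\<close>, so the change of \<open>li n k\<close> from its value at \<open>a\<close> is the
  difference estimated by \<open>li_diff_le\<close>.\<close>

lemma tau_pi_vertical_tangent:
  assumes S: "open S" "\<And>n. n \<in> S \<Longrightarrow> n \<ge> 2 \<and> prime_pi n = m" and a: "a \<in> S"
    and k: "k \<ge> 1" "tau_pi a = real k" and nz: "ln a ^ k \<noteq> fact k"
  shows "has_vertical_tangent tau_pi a"
proof -
  have cont: "isCont tau_pi a" using S a by (rule tau_pi_isCont)
  have a1: "a > 1" using S(2)[OF a] by simp
  note tau = tau_pi[OF conjunct1[OF S(2)]]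
  define g where "g = (\<lambda>n. li n (real k))"
  define c where "c = (\<lambda>n. n / ln n * (fact (k - 1) / ln n ^ (k - 1) + fact k / ln n ^ k) :: real)"
  have ga: "g a = real m" using tau(2)[OF a] S(2)[OF a] k(2) by (simp add: g_def)
  have inS: "eventually (\<lambda>n. n \<in> S) (at a)"
    using S(1) a by (rule eventually_at_in_open')
  have "(tau_pi \<longlongrightarrow> real k) (at a)" using cont k(2) by (simp add: isCont_def)
  then have near: "eventually (\<lambda>n. dist (tau_pi n) (real k) < 1) (at a)"
    by (rule tendstoD) simp
  have "isCont c a"
    unfolding c_def using a1 by (intro continuous_intros) auto
  then have "eventually (\<lambda>n. c n < c a + 1) (at a)"
    unfolding isCont_def by (rule order_tendstoD) simp
  then have bound: "eventually (\<lambda>n. \<bar>g n - g a\<bar> \<le> (c a + 1) * 35 * \<bar>tau_pi n - tau_pi a\<bar> ^ 4) (at a)"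
    using inS near
  proof eventually_elim
    case (elim n)
    have "\<bar>li n (tau_pi n) - g n\<bar> \<le> c n * (35 * \<bar>tau_pi n - real k\<bar> ^ 4)"
      unfolding g_def c_def using elim S(2)[of n] k(1) by (intro li_diff_le) (auto simp: dist_real_def)
    also have "\<dots> \<le> (c a + 1) * (35 * \<bar>tau_pi n - real k\<bar> ^ 4)"
      using elim by (intro mult_right_mono) auto
    finally have "\<bar>li n (tau_pi n) - g n\<bar> \<le> (c a + 1) * 35 * \<bar>tau_pi n - tau_pi a\<bar> ^ 4"
      by (simp only: k(2) mult.assoc)
    moreover have "li n (tau_pi n) = g a" using tau(2)[of n] S(2)[of n] elim ga by simp
    ultimately show ?case by (simp only: abs_minus_commute)
  qed
  \<comment> \<open>For fixed \<open>n\<close>, \<open>tau_pi n\<close> lies above \<open>k\<close>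
    exactly when \<open>li n k\<close> lies below \<open>m\<close>.\<close>
  have sgn: "eventually (\<lambda>n. (tau_pi n - tau_pi a) * (g n - g a) \<le> 0) (at a)"
    using inS
  proof eventually_elim
    case (elim n)
    have n: "n > 1" "tau_pi n > 0" "li n (tau_pi n) = real m"
      using elim tau[of n] S(2)[of n] by auto
    show ?case
      using li_le_cancel[of n "real k" "tau_pi n"] li_le_cancel[of n "tau_pi n" "real k"] n ga k(2)
      by (auto simp: g_def mult_le_0_iff)
  qed
  have "ln a > 0" using a1 by simp
  then have "1 / ln a - fact k / ln a ^ Suc k \<noteq> 0"
    using nz by (simp add: field_simps)
  then show ?thesis
    using has_vertical_tangentI[OF cont _ _ sgn bound] li_has_derivative[OF a1, of k]
    unfolding g_def by blast
qed

lemma prime_pi_between: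
  assumes "m \<ge> 1" "n \<in> {real (nth_prime m)<..<real (nth_prime (m + 1))}"
  shows "n \<ge> 2" "prime_pi n = m"
proof -
  let ?e = "enumerate {p::nat. prime p}"
  have e: "prime (?e i)" for i
    using enumerate_in_set[OF primes_infinite] by blast
  have n: "real (?e (m - 1)) < n" "n < real (?e m)"
    using assms(2) by (auto simp: nth_prime_def)
  show "n \<ge> 2" using n(1) prime_ge_2_nat[OF e[of "m - 1"]] by linarith
  \<comment> \<open>With enumeration from 0, the \<open>m\<close>-th prime has index
    \<open>m - 1\<close>, so exactly the indices below \<open>m\<close> count.\<close>
  have "{p::nat. prime p \<and> real p \<le> n} = ?e ` {..<m}"
  proof (intro set_eqI iffI)
    fix p assume p: "p \<in> {p::nat. prime p \<and> real p \<le> n}"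
    then obtain i where i: "?e i = p" using enumerate_Ex[OF primes_infinite, of p] by auto
    then have "?e i < ?e m" using p n(2) by simp
    then have "i < m" using primes_infinite by simp
    then show "p \<in> ?e ` {..<m}" using i by blast
  next
    fix p assume "p \<in> ?e ` {..<m}"
    then obtain i where i: "p = ?e i" "i \<le> m - 1" using assms(1) by auto
    then have "?e i \<le> ?e (m - 1)" using primes_infinite by simp
    then show "p \<in> {p::nat. prime p \<and> real p \<le> n}" using n(1) e[of i] i by auto
  qed
  moreover have "inj_on ?e {..<m}"
    using inj_enumerate[OF primes_infinite] by (rule inj_on_subset) simp
  ultimately show "prime_pi n = m" by (simp add: prime_pi_def card_image)
qed

theorem theorem2p6:
  shows "(\<forall>n::real. n \<ge> 2 \<longrightarrow> (\<exists>!\<tau>::real. 0 < \<tau> \<and> li n \<tau> = real (prime_pi n))) \<and>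
    (\<forall>m::nat. m \<ge> 1 \<longrightarrow>
      continuous_on {real (nth_prime m)<..<real (nth_prime (m + 1))} tau_pi \<and>
      (\<forall>n \<in> {real (nth_prime m)<..<real (nth_prime (m + 1))}. \<forall>k::nat.
        k \<ge> 1 \<and> tau_pi n = real k \<longrightarrow>
          isCont tau_pi n \<and> \<not> tau_pi differentiable (at n) \<and> has_vertical_tangent tau_pi n))"
proof (intro conjI allI impI ballI)
  show "\<exists>!\<tau>. 0 < \<tau> \<and> li n \<tau> = real (prime_pi n)" if "n \<ge> 2" for n
    using that by (rule tau_pi_ex1)
next
  fix m :: nat assume m: "m \<ge> 1"
  let ?S = "{real (nth_prime m)<..<real (nth_prime (m + 1))}"
  have S: "n \<ge> 2 \<and> prime_pi n = m" if "n \<in> ?S" for n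
    using prime_pi_between[OF m that] by blast
  have cont: "isCont tau_pi n" if "n \<in> ?S" for n
    using open_greaterThanLessThan S that by (rule tau_pi_isCont)
  then show "continuous_on ?S tau_pi"
    by (simp add: continuous_at_imp_continuous_on)
  fix n k assume n: "n \<in> ?S" and k: "k \<ge> 1 \<and> tau_pi n = real k"
  show "isCont tau_pi n" using n by (rule cont)
  have n2: "n \<ge> 2" using S[OF n] by blast
  \<comment> \<open>At a critical point \<open>prime_pi n\<close> is strictly below
    \<open>li n k\<close>, whereas \<open>tau_pi n = k\<close> forces equality.\<close>
  have "ln n ^ k \<noteq> fact k"
  proof
    assume "ln n ^ k = fact k"
    then have "real (prime_pi n) < li n (real k)"
      using prime_pi_less_critical[of "ln n" k] n2 k by (simp add: li_of_nat)
    then show False using tau_pi(2)[OF n2] k by simp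
  qed
  then show "has_vertical_tangent tau_pi n"
    using tau_pi_vertical_tangent[OF open_greaterThanLessThan S n] k by blast
  then show "\<not> tau_pi differentiable (at n)"
    by (rule vertical_tangent_not_differentiable)
qed

end
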